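(* Let $G$ be a graph admitting a nowhere-zero $4$-flow. Then $$\phi_{2,p}(G)\le\begin{cases}1+2^{1-1/p}, & 1\le p\le 2,\\ 1+2^{1/p}, & p\in[2,\infty],\end{cases}$$ (with $2^{1/\infty}=1$). In particular $\phi_{2,1}(G)=\phi_{2,\infty}(G)=2$. Moreover, for every $p\in[1,\infty]$ the bound is attained (i.e., holds with equality) by every graph that admits a nowhere-zero $4$-flow and is contractible to $K_4$.
   Context: All graphs are finite and may have multiple edges but no loops. A nowhere-zero $k$-flow ($k$-NZF) of $G$ is a pair $(D,f)$ with $D$ an orientation and $f:E(G)\to\mathbb{Z}$ with $0<|f(e)|<k$ satisfying flow conservation at every vertex. For an orientation $D$ and vertex $v$, $E_D^+(v)$, $E_D^-(v)$ are the out- and in-edges. For $\Omega\subseteq\mathbb{R}^d$, a vector $\Omega$-flow of $G$ is $(D,f)$ with $f:E(G)\to\Omega$ and $\sum_{e\in E_D^+(v)}f(e)-\sum_{e\in E_D^-(v)}f(e)=\mathbf{0}$ for every vertex $v$. $\|x\|_p$ is the usual $p$-norm, $\|x\|_\infty=\max_i|x_i|$. For integer $d\ge1$, real $r\ge2$, $p\in[1,\infty]$, an $(r,d,p)$-NZF is a vector $(\mathbb{R}^d\setminus\{\mathbf{0}\})$-flow $(D,f)$ with $1\le\|f(e)\|_p\le r-1$ for all edges. For a bridgeless graph $G$, $\phi_{d,p}(G)$ is the infimum of real $r$ such that $G$ admits an $(r,d,p)$-NZF. A graph $H$ is contractible to a graph $K$ if $K$ can be obtained from $H$ by repeatedly identifying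 vertices and deleting resulting loops. *)

theory Defs
  imports "HOL-Analysis.Analysis" "Graph_Theory.Digraph"
begin

text \<open>
  Undirected multigraphs: every edge has its own name, and \<open>ends\<close> maps it to the set of its
  end-vertices, so that parallel edges are distinct edges with the same ends.
\<close>

record ('v, 'e) multigraph =
  vertices :: "'v set"
  edges :: "'e set"
  ends :: "'e \<Rightarrow> 'v set"

definition finite_loopless :: "('v, 'e) multigraph \<Rightarrow> bool" where
  "finite_loopless G \<longleftrightarrow>
     finite (vertices G) \<and> finite (edges G) \<and>
     (\<forall>e\<in>edges G. ends G e \<subseteq> vertices G \<and> card (ends G e) = 2)"

text \<open>An orientation is a digraph on the same vertices and the same edge names.\<close>

definition is_orientation :: "('v, 'e) multigraph \<Rightarrow> ('v, 'e) pre_digraph \<Rightarrow> bool" where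
  "is_orientation G D \<longleftrightarrow>
     verts D = vertices G \<and> arcs D = edges G \<and>
     (\<forall>e\<in>edges G. ends G e = {tail D e, head D e})"

definition flow_conservation ::
    "('v, 'e) pre_digraph \<Rightarrow> ('e \<Rightarrow> 'a::ab_group_add) \<Rightarrow> bool" where
  "flow_conservation D f \<longleftrightarrow>
     (\<forall>v\<in>verts D. (\<Sum>e\<in>out_arcs D v. f e) - (\<Sum>e\<in>in_arcs D v. f e) = 0)"

definition is_NZF ::
    "int \<Rightarrow> ('v, 'e) multigraph \<Rightarrow> ('v, 'e) pre_digraph \<Rightarrow> ('e \<Rightarrow> int) \<Rightarrow> bool" where
  "is_NZF k G D f \<longleftrightarrow>
     is_orientation G D \<and> flow_conservation D f \<and>
     (\<forall>e\<in>edges G. 0 < \<bar>f e\<bar> \<and> \<bar>f e\<bar> < k)"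

definition admits_NZF :: "int \<Rightarrow> ('v, 'e) multigraph \<Rightarrow> bool" where
  "admits_NZF k G \<longleftrightarrow> (\<exists>D f. is_NZF k G D f)"

definition is_vector_flow ::
    "(real ^ 'd) set \<Rightarrow> ('v, 'e) multigraph \<Rightarrow> ('v, 'e) pre_digraph \<Rightarrow>
     ('e \<Rightarrow> real ^ 'd) \<Rightarrow> bool" where
  "is_vector_flow \<Omega> G D f \<longleftrightarrow>
     is_orientation G D \<and> (\<forall>e\<in>edges G. f e \<in> \<Omega>) \<and> flow_conservation D f"

text \<open>
  The \<open>p\<close>-norm for \<open>p \<in> [1, \<infinity>]\<close>; on \<open>real ^ 'd\<close>, \<open>infnorm x\<close> is the largest absolute value
  of a coordinate of \<open>x\<close>. Values of \<open>p\<close> below 1 are not meaningful.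
\<close>

definition pnorm :: "ereal \<Rightarrow> real ^ 'd \<Rightarrow> real" where
  "pnorm p x =
     (if p = \<infinity> then infnorm x
      else (\<Sum>i\<in>UNIV. \<bar>x $ i\<bar> powr real_of_ereal p) powr (1 / real_of_ereal p))"

text \<open>An \<open>(r, d, p)\<close>-NZF; the dimension \<open>d\<close> is the cardinality of the index type \<open>'d\<close>.\<close>

definition is_vector_NZF ::
    "real \<Rightarrow> ereal \<Rightarrow> ('v, 'e) multigraph \<Rightarrow> ('v, 'e) pre_digraph \<Rightarrow>
     ('e \<Rightarrow> real ^ 'd) \<Rightarrow> bool" where
  "is_vector_NZF r p G D f \<longleftrightarrow>
     2 \<le> r \<and> is_vector_flow (UNIV - {0}) G D f \<and>
     (\<forall>e\<in>edges G. 1 \<le> pnorm p (f e) \<and> pnorm p (f e) \<le> r - 1)"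

text \<open>
  The infimum is taken in the extended reals, so that it is \<open>\<infinity>\<close> when there is no
  \<open>(r, d, p)\<close>-NZF for any \<open>r\<close> (that is, when the graph has a bridge).
\<close>

definition phi :: "'d::finite itself \<Rightarrow> ereal \<Rightarrow> ('v, 'e) multigraph \<Rightarrow> ereal" where
  "phi _ p G = Inf {ereal r | r. \<exists>D (f :: 'e \<Rightarrow> real ^ 'd). is_vector_NZF r p G D f}"

text \<open>
  Identifying \<open>v\<close> with \<open>u\<close> (the merged vertex is called \<open>u\<close>) and deleting the resulting loops,
  which are precisely the edges that joined \<open>u\<close> and \<open>v\<close>. The two vertices need not be adjacent,
  and parallel edges are kept.
\<close>

definition identify :: "'v \<Rightarrow> 'v \<Rightarrow> ('v, 'e) multigraph \<Rightarrow> ('v, 'e) multigraph" where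
  "identify u v G =
     \<lparr> vertices = id(v := u) ` vertices G,
       edges = {e \<in> edges G. ends G e \<noteq> {u, v}},
       ends = (\<lambda>e. id(v := u) ` ends G e) \<rparr>"

definition identification_step :: "('v, 'e) multigraph \<Rightarrow> ('v, 'e) multigraph \<Rightarrow> bool" where
  "identification_step G H \<longleftrightarrow>
     (\<exists>u\<in>vertices G. \<exists>v\<in>vertices G. u \<noteq> v \<and> H = identify u v G)"

definition isomorphic :: "('v, 'e) multigraph \<Rightarrow> ('w, 'a) multigraph \<Rightarrow> bool" where
  "isomorphic G H \<longleftrightarrow>
     (\<exists>\<alpha> \<beta>. bij_betw \<alpha> (vertices G) (vertices H) \<and> bij_betw \<beta> (edges G) (edges H) \<and>
            (\<forall>e\<in>edges G. ends H (\<beta> e) = \<alpha> ` ends G e))"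

definition contractible_to :: "('v, 'e) multigraph \<Rightarrow> ('w, 'a) multigraph \<Rightarrow> bool" where
  "contractible_to H K \<longleftrightarrow> (\<exists>H'. identification_step\<^sup>*\<^sup>* H H' \<and> isomorphic H' K)"

definition K4 :: "(nat, nat set) multigraph" where
  "K4 = \<lparr> vertices = {0..<4}, edges = {e. e \<subseteq> {0..<4} \<and> card e = 2}, ends = id \<rparr>"

end

theory Submission
  imports Defs
begin

text \<open>
  Upper bound: the edges with odd value of a nowhere-zero 4-flow form an even subgraph, which has
  a flow \<open>g\<close> with values \<open>\<plusminus>1\<close> on it; halving the sum with the original flow and repeating gives
  a second flow \<open>h\<close>, so that \<open>(g, h)\<close> has values in \<open>{-1, 0, 1}\<^sup>2 - {0}\<close>. Their \<open>p\<close>-norms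
  lie between \<open>1\<close> and \<open>2\<^bsup>1/p\<^esup>\<close>; after rotating by 45 degrees and rescaling, between \<open>1\<close> and
  \<open>2\<^bsup>1-1/p\<^esup>\<close>.

  Lower bound: contraction to \<open>K4\<close> turns a vector flow into one on \<open>K4\<close>, that is (by planar duality)
  into the differences of four points of the plane. Three of these points form a Euclidean angle of at
  least 90 degrees. Since the \<open>p\<close>-norm is invariant under the rotation by 90 degrees, the
  difference of two vectors of norm at least \<open>1\<close> at an obtuse angle has norm at least the minimum
  of \<open>\<parallel>x - rot x\<parallel>\<close> over unit vectors \<open>x\<close>, which Clarkson's inequalities show to be the claimed bound.
\<close>

section \<open>Power inequalities\<close>

text \<open>The boundary point 0 is treated apart: if \<open>a\<close> or \<open>b\<close> vanishes,
  the claim reduces to \<open>s powr q \<le> s\<close> for a weight \<open>s\<close> in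
  [0,1].\<close>

lemma powr_convex_nonneg:
  fixes a b t q :: real
  assumes q: "1 \<le> q" and ab: "0 \<le> a" "0 \<le> b" and t: "0 \<le> t" "t \<le> 1"
  shows "(t * a + (1 - t) * b) powr q \<le> t * a powr q + (1 - t) * b powr q"
proof -
  have scale: "(s * c) powr q \<le> s * c powr q" if "0 \<le> s" "s \<le> 1" "0 \<le> c" for s c :: real
  proof -
    have "s powr q \<le> s" using powr_mono'[of 1 q s] that q by simp
    then show ?thesis using that by (simp add: powr_mult mult_right_mono)
  qed
  show ?thesis
  proof (cases "a = 0 \<or> b = 0")
    case True
    then show ?thesis using scale[of t a] scale[of "1 - t" b] ab t by auto
  next
    case False
    then show ?thesis
      using convex_onD[OF powr_convex[OF q], of t b a] ab t by (simp add: add.commute)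
  qed
qed

text \<open>The shares \<open>a / (a + b)\<close> and \<open>b / (a + b)\<close> are at most 1, so
  raising them to the power \<open>q\<close> does not increase them, and they add up to 1.\<close>

lemma powr_superadditive:
  fixes a b q :: real
  assumes q: "1 \<le> q" and ab: "0 \<le> a" "0 \<le> b"
  shows "a powr q + b powr q \<le> (a + b) powr q"
proof (cases "a + b = 0")
  case True
  then have "a = 0" "b = 0" using ab by linarith+
  then show ?thesis by simp
next
  case False
  have *: "c powr q \<le> c / (a + b) * (a + b) powr q" if "0 \<le> c" "c \<le> a + b" for c
  proof -
    have "(c / (a + b)) powr q \<le> c / (a + b)"
      using powr_mono'[of 1 q "c / (a + b)"] that q False ab by (simp add: divide_le_eq)
    then have "(c / (a + b)) powr q * (a + b) powr q \<le> c / (a + b) * (a + b) powr q"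
      by (rule mult_right_mono) simp
    then show ?thesis using that False ab by (simp add: powr_divide)
  qed
  have "a powr q + b powr q \<le> a / (a + b) * (a + b) powr q + b / (a + b) * (a + b) powr q"
    using *[of a] *[of b] ab by simp
  also have "\<dots> = (a + b) powr q" using False by (simp flip: distrib_right add_divide_distrib)
  finally show ?thesis .
qed

text \<open>Superadditivity with exponent \<open>1 / r\<close>, applied to \<open>a powr r\<close>
  and \<open>b powr r\<close>.\<close>

lemma powr_subadditive:
  fixes a b r :: real
  assumes r: "0 < r" "r \<le> 1" and ab: "0 \<le> a" "0 \<le> b"
  shows "(a + b) powr r \<le> a powr r + b powr r"
proof -
  have "(a powr r) powr (1 / r) + (b powr r) powr (1 / r) \<le> (a powr r + b powr r) powr (1 / r)"
    using r by (intro powr_superadditive) auto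
  then have "a + b \<le> (a powr r + b powr r) powr (1 / r)"
    using r ab by (simp add: powr_powr)
  then have "(a + b) powr r \<le> ((a powr r + b powr r) powr (1 / r)) powr r"
    using r ab by (intro powr_mono2) auto
  then show ?thesis using r by (simp add: powr_powr)
qed

lemma abs_powr_eq_square: "\<bar>x\<bar> powr q = (x\<^sup>2) powr (q / 2)" for x q :: real
proof -
  have "(x\<^sup>2) powr (q / 2) = (\<bar>x\<bar> powr 2) powr (q / 2)" by simp
  then show ?thesis by (simp only: powr_powr) simp
qed

section \<open>Clarkson's inequalities for two reals\<close>

text \<open>By the parallelogram law, the sum of the squares of \<open>s\<close> and
  \<open>t\<close> is the mean of the squares of \<open>s + t\<close> and \<open>s - t\<close>.
  Superadditivity and then convexity of the power \<open>q / 2\<close> give the claim.\<close>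

lemma clarkson_ge_2:
  fixes s t q :: real
  assumes q: "2 \<le> q"
  shows "2 * (\<bar>s\<bar> powr q + \<bar>t\<bar> powr q) \<le> \<bar>s + t\<bar> powr q + \<bar>s - t\<bar> powr q"
proof -
  let ?r = "q / 2"
  have r: "1 \<le> ?r" using q by simp
  have "(s\<^sup>2) powr ?r + (t\<^sup>2) powr ?r \<le> (s\<^sup>2 + t\<^sup>2) powr ?r"
    by (rule powr_superadditive[OF r]) auto
  also have "s\<^sup>2 + t\<^sup>2 = 1/2 * (s + t)\<^sup>2 + (1 - 1/2) * (s - t)\<^sup>2"
    by (simp add: power2_eq_square algebra_simps)
  also have "\<dots> powr ?r \<le> 1/2 * ((s + t)\<^sup>2) powr ?r + (1 - 1/2) * ((s - t)\<^sup>2) powr ?r"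
    by (rule powr_convex_nonneg[OF r]) auto
  finally show ?thesis by (simp add: abs_powr_eq_square)
qed

text \<open>Now \<open>q / 2\<close> is at most 1, so convexity is used for the inverse exponent, on
  the powers \<open>U\<close> and \<open>V\<close>, and subadditivity replaces
  superadditivity.\<close>

lemma clarkson_le_2:
  fixes s t q :: real
  assumes q: "0 < q" "q \<le> 2"
  shows "\<bar>s + t\<bar> powr q + \<bar>s - t\<bar> powr q \<le> 2 * (\<bar>s\<bar> powr q + \<bar>t\<bar> powr q)"
proof -
  let ?r = "q / 2"
  define U V where "U = ((s + t)\<^sup>2) powr ?r" and "V = ((s - t)\<^sup>2) powr ?r"
  have "(1/2 * U + (1 - 1/2) * V) powr (1 / ?r)
      \<le> 1/2 * U powr (1 / ?r) + (1 - 1/2) * V powr (1 / ?r)"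
    using q by (intro powr_convex_nonneg) (auto simp: U_def V_def)
  also have "\<dots> = s\<^sup>2 + t\<^sup>2"
  proof -
    have "U powr (1 / ?r) = (s + t)\<^sup>2" "V powr (1 / ?r) = (s - t)\<^sup>2"
      using q by (simp_all add: U_def V_def powr_powr)
    then show ?thesis by (simp add: power2_eq_square algebra_simps)
  qed
  finally have "((1/2 * U + (1 - 1/2) * V) powr (1 / ?r)) powr ?r \<le> (s\<^sup>2 + t\<^sup>2) powr ?r"
    using q by (intro powr_mono2) auto
  then have "(U + V) / 2 \<le> (s\<^sup>2 + t\<^sup>2) powr ?r"
    using q by (simp add: powr_powr U_def V_def add_divide_distrib)
  also have "\<dots> \<le> (s\<^sup>2) powr ?r + (t\<^sup>2) powr ?r"
    using q by (intro powr_subadditive) auto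
  finally show ?thesis by (simp add: abs_powr_eq_square U_def V_def)
qed

text \<open>\<open>clarkson_le_2\<close> is applied to \<open>s + t\<close> and
  \<open>s - t\<close>, whose sum and difference are \<open>2 * s\<close> and
  \<open>2 * t\<close>.\<close>

lemma clarkson_dual:
  fixes s t q :: real
  assumes q: "0 < q" "q \<le> 2"
  shows "2 powr (q - 1) * (\<bar>s\<bar> powr q + \<bar>t\<bar> powr q) \<le> \<bar>s + t\<bar> powr q + \<bar>s - t\<bar> powr q"
proof -
  have "2 powr q * (\<bar>s\<bar> powr q + \<bar>t\<bar> powr q) = \<bar>2 * s\<bar> powr q + \<bar>2 * t\<bar> powr q"
    by (simp add: abs_mult powr_mult distrib_left)
  also have "\<dots> \<le> 2 * (\<bar>s + t\<bar> powr q + \<bar>s - t\<bar> powr q)"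
    using clarkson_le_2[OF q, of "s + t" "s - t"] by (simp add: algebra_simps)
  finally show ?thesis by (simp add: powr_diff)
qed

section \<open>Four points in a plane with a norm invariant under rotation by 90 degrees\<close>

text \<open>Along the line in direction \<open>z\<close>, the map from \<mu> to
  \<open>N (x - \<mu> *\<^sub>R z)\<close> is convex and has equal values at -1 and 1, so from 1
  onwards it stays at or above its value at 1.\<close>

lemma norm_diff_scale_mono:
  fixes N :: "'a::real_vector \<Rightarrow> real"
  assumes tri: "\<And>x y. N (x + y) \<le> N x + N y"
    and scale: "\<And>c x. N (c *\<^sub>R x) = \<bar>c\<bar> * N x"
    and sym: "N (x + z) = N (x - z)" and "1 \<le> \<mu>"
  shows "N (x - z) \<le> N (x - \<mu> *\<^sub>R z)"
proof -
  \<comment> \<open>The weight for which \<open>x - z\<close> is the convex combination of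
    \<open>x - \<mu> *\<^sub>R z\<close> and \<open>x + z\<close>.\<close>
  define t where "t = 2 / (1 + \<mu>)"
  have "t * (1 + \<mu>) = 2" "0 < t" "t \<le> 1"
    using \<open>1 \<le> \<mu>\<close> by (simp_all add: t_def field_simps)
  then have t: "0 < t" "t \<le> 1" "1 - t - t * \<mu> = - 1"
    by (simp_all add: algebra_simps)
  have "t *\<^sub>R (x - \<mu> *\<^sub>R z) + (1 - t) *\<^sub>R (x + z) = x + (1 - t - t * \<mu>) *\<^sub>R z"
    by (simp add: algebra_simps)
  then have "x - z = t *\<^sub>R (x - \<mu> *\<^sub>R z) + (1 - t) *\<^sub>R (x + z)"
    using t(3) by simp
  then have "N (x - z) \<le> t * N (x - \<mu> *\<^sub>R z) + (1 - t) * N (x - z)"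
    using tri[of "t *\<^sub>R (x - \<mu> *\<^sub>R z)" "(1 - t) *\<^sub>R (x + z)"] t by (simp add: scale sym)
  then have "t * N (x - z) \<le> t * N (x - \<mu> *\<^sub>R z)"
    by (simp add: algebra_simps)
  with t(1) show ?thesis by simp
qed

text \<open>\<open>y\<close> lies in the cone of \<open>z\<close> and \<open>- x\<close>, so the
  segment from \<open>x\<close> to \<open>y\<close> meets the ray of \<open>z\<close>. If it does so
  no later than at \<open>z\<close>, the triangle inequality at the crossing gives
  \<open>N (x - z) + N y \<le> N (x - y) + N z\<close>, and \<open>N z \<le> N y\<close> finishes.
  Otherwise monotonicity along the ray applies.\<close>

lemma norm_diff_sector:
  fixes N :: "'a::real_vector \<Rightarrow> real"
  assumes tri: "\<And>x y. N (x + y) \<le> N x + N y"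
    and scale: "\<And>c x. N (c *\<^sub>R x) = \<bar>c\<bar> * N x"
    and sym: "N (x + z) = N (x - z)" and zx: "N z = N x" and xy: "N x \<le> N y"
    and y: "y = l *\<^sub>R z - k *\<^sub>R x" and l: "0 \<le> l" and k: "0 \<le> k"
  shows "N (x - z) \<le> N (x - y)"
proof (cases "l \<le> 1 + k")
  case True
  \<comment> \<open>The segments from \<open>x\<close> to \<open>y\<close> and from \<open>0\<close> to \<open>z\<close> cross in \<open>w\<close>.\<close>
  define c where "c = inverse (1 + k)"
  have c: "c > 0" "c + c * k = 1" using k by (auto simp: c_def field_simps)
  define w where "w = (c * l) *\<^sub>R z"
  have cl: "0 \<le> c * l" "c * l \<le> 1" using True k l by (auto simp: c_def field_simps)
  have "w = c *\<^sub>R (k *\<^sub>R x + y)" by (simp add: w_def y)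
  then have w: "w = (c * k) *\<^sub>R x + c *\<^sub>R y" by (simp add: algebra_simps)
  have e1: "x - w = c *\<^sub>R (x - y)"
  proof -
    have "x - w = (1 - c * k) *\<^sub>R x - c *\<^sub>R y" by (simp add: w algebra_simps)
    also have "1 - c * k = c" using c by simp
    finally show ?thesis by (simp add: algebra_simps)
  qed
  have e2: "y - w = (- (c * k)) *\<^sub>R (x - y)"
  proof -
    have "y - w = (1 - c) *\<^sub>R y - (c * k) *\<^sub>R x" by (simp add: w algebra_simps)
    also have "1 - c = c * k" using c by simp
    finally show ?thesis by (simp add: algebra_simps)
  qed
  have e3: "w - z = (c * l - 1) *\<^sub>R z" by (simp add: w_def algebra_simps)
  have "N (x - z) \<le> N (x - w) + N (w - z)" using tri[of "x - w" "w - z"] by simp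
  moreover have "N y \<le> N (y - w) + N w" using tri[of "y - w" w] by simp
  moreover have "N (x - w) = c * N (x - y)" "N (y - w) = c * k * N (x - y)"
    using c k by (simp_all only: e1 e2 scale abs_mult abs_minus abs_of_pos abs_of_nonneg)
  moreover have "N (w - z) = (1 - c * l) * N z" using cl by (simp only: e3 scale) simp
  moreover have "N w = c * l * N z" using cl by (simp add: w_def scale)
  ultimately have "N (x - z) + N y \<le> (c + c * k) * N (x - y) + N z"
    by (simp add: algebra_simps)
  then show ?thesis using c xy zx by simp
next
  case False
  \<comment> \<open>The crossing point is \<open>\<mu> *\<^sub>R z\<close>, beyond \<open>z\<close>,
    and \<open>x - y\<close> is \<open>1 + k\<close> times
    \<open>x - \<mu> *\<^sub>R z\<close>.\<close>
  define \<mu> where "\<mu> = l / (1 + k)"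
  have \<mu>: "1 \<le> \<mu>" "(1 + k) * \<mu> = l" using False k by (auto simp: \<mu>_def field_simps)
  have "N (x - z) \<le> N (x - \<mu> *\<^sub>R z)" by (rule norm_diff_scale_mono[OF tri scale sym \<mu>(1)])
  also have "\<dots> \<le> (1 + k) * N (x - \<mu> *\<^sub>R z)"
  proof -
    have "0 \<le> N (x - \<mu> *\<^sub>R z)"
      using tri[of "x - \<mu> *\<^sub>R z" "- 1 *\<^sub>R (x - \<mu> *\<^sub>R z)"] scale[of 0 0] scale[of "- 1" "x - \<mu> *\<^sub>R z"]
      by simp
    then show ?thesis using k by (simp add: algebra_simps)
  qed
  also have "\<dots> = N ((1 + k) *\<^sub>R (x - \<mu> *\<^sub>R z))" using k by (simp add: scale)
  also have "(1 + k) *\<^sub>R (x - \<mu> *\<^sub>R z) = (1 + k) *\<^sub>R x - l *\<^sub>R z"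
    by (simp only: scaleR_diff_right scaleR_scaleR \<mu>(2))
  also have "\<dots> = x - y" by (simp add: y algebra_simps)
  finally show ?thesis .
qed

definition rot :: "real ^ 2 \<Rightarrow> real ^ 2" where
  "rot x = vector [- (x $ 2), x $ 1]"

text \<open>By symmetry let \<open>N x \<le> N y\<close>. The angle being at least 90 degrees,
  \<open>y\<close> lies in the cone of \<open>- x\<close> and one of \<open>rot x\<close>,
  \<open>- rot x\<close>, so that the sector lemma compares \<open>x - y\<close> with
  \<open>x - rot x\<close> or \<open>x + rot x\<close>.\<close>

lemma norm_diff_obtuse:
  fixes N :: "real ^ 2 \<Rightarrow> real"
  assumes tri: "\<And>x y. N (x + y) \<le> N x + N y"
    and scale: "\<And>c x. N (c *\<^sub>R x) = \<bar>c\<bar> * N x"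
    and rot: "\<And>x. N (rot x) = N x"
    and g: "\<And>x. g * N x \<le> N (x - rot x)" "0 \<le> g"
    and xy: "x \<bullet> y \<le> 0" "1 \<le> N x" "1 \<le> N y"
  shows "g \<le> N (x - y)"
proof -
  have sector: "g \<le> N (x - y)"
    if le: "N x \<le> N y" "x \<bullet> y \<le> 0" "1 \<le> N x" for x y
  proof -
    have "x \<noteq> 0" using scale[of 0 x] le by auto
    define n where "n = (x $ 1)\<^sup>2 + (x $ 2)\<^sup>2"
    have n: "n > 0"
      using \<open>x \<noteq> 0\<close> by (auto simp: n_def vec_eq_iff forall_2 sum_power2_gt_zero_iff)
    \<comment> \<open>\<open>l\<close> and \<open>- k\<close> are the coordinates of
      \<open>y\<close> in the orthogonal basis \<open>rot x\<close>, \<open>x\<close>, both of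
      squared Euclidean length \<open>n\<close>.\<close>
    define k where "k = - (x \<bullet> y) / n"
    define l where "l = (rot x \<bullet> y) / n"
    have k: "0 \<le> k" using le n by (simp add: k_def field_simps)
    have y: "y = l *\<^sub>R rot x - k *\<^sub>R x"
      using n unfolding l_def k_def
      by (simp add: vec_eq_iff forall_2 rot_def inner_vec_def sum_2 field_simps)
        (simp add: n_def power2_eq_square algebra_simps)
    have plus: "N (x + rot x) = N (x - rot x)"
    proof -
      have "rot (x - rot x) = x + rot x" by (simp add: vec_eq_iff forall_2 rot_def)
      then show ?thesis using rot[of "x - rot x"] by simp
    qed
    have neg: "N (- z) = N z" for z using scale[of "- 1" z] by simp
    have "N (x - rot x) \<le> N (x - y)"
    proof (cases "0 \<le> l")
      case True
      show ?thesis
        by (rule norm_diff_sector[OF tri scale plus rot le(1) y True k])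
    next
      case False
      \<comment> \<open>Here \<open>y\<close> lies on the other side of the line through
        \<open>x\<close>, so \<open>- rot x\<close> takes the role of \<open>z\<close>.\<close>
      have "N (x - - rot x) \<le> N (x - y)"
        by (rule norm_diff_sector[OF tri scale _ _ le(1) _ _ k, where l = "- l"])
          (use False y plus neg rot in auto)
      then show ?thesis using plus by simp
    qed
    moreover have "g \<le> g * N x" using g(2) le mult_left_mono[of 1 "N x" g] by simp
    ultimately show ?thesis using g(1)[of x] by linarith
  qed
  have "N (y - x) = N (x - y)" using scale[of "- 1" "x - y"] by simp
  moreover have "y \<bullet> x \<le> 0" using xy(1) by (simp only: inner_commute)
  ultimately show ?thesis using sector[of x y] sector[of y x] xy by linarith
qed

section \<open>Angles among four points of the plane\<close>

text \<open>The points are 0, \<open>u\<close>, \<open>v\<close>, \<open>w\<close>, and the inner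
  products are angles at them. If \<open>s + t \<le> 1\<close>, then \<open>v\<close> lies in the
  triangle of 0, \<open>u\<close>, \<open>w\<close> and cannot see both sides at 0 under acute
  angles. Otherwise 0, \<open>u\<close>, \<open>v\<close>, \<open>w\<close> is a (possibly
  degenerate) convex quadrilateral, whose four angles cannot all be acute.\<close>

lemma acute_quadrilateral_False:
  fixes u v w :: "'a::real_inner"
  assumes v: "v = s *\<^sub>R u + t *\<^sub>R w" "0 \<le> s" "0 \<le> t"
    and "0 < u \<bullet> w" "0 < v \<bullet> (v - u)" "0 < v \<bullet> (v - w)" "0 < u \<bullet> (u - v)" "0 < w \<bullet> (w - v)"
    and "0 < (u - v) \<bullet> (w - v)"
  shows False
proof (cases "s + t \<le> 1")
  case True
  show False
  proof (cases "s = 0 \<and> t = 0")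
    case True
    then show False using assms by simp
  next
    case False
    have "s * (v \<bullet> u) + t * (v \<bullet> w) < s * (v \<bullet> v) + t * (v \<bullet> v)"
    proof (cases "s = 0")
      case True
      then show ?thesis using False assms by (auto simp: inner_diff_right)
    next
      case False
      then have "s * (v \<bullet> u) < s * (v \<bullet> v)" using assms by (auto simp: inner_diff_right)
      moreover have "t * (v \<bullet> w) \<le> t * (v \<bullet> v)"
        by (intro mult_left_mono) (use assms in \<open>auto simp: inner_diff_right\<close>)
      ultimately show ?thesis by linarith
    qed
    moreover have "(s + t) * (v \<bullet> v) \<le> 1 * (v \<bullet> v)" using True by (intro mult_right_mono) auto
    moreover have "v \<bullet> v = s * (v \<bullet> u) + t * (v \<bullet> w)"
      by (subst (2) v(1)) (simp add: inner_add_right)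
    ultimately show False by (simp add: algebra_simps)
  qed
next
  case False
  \<comment> \<open>In these terms the acute angles at \<open>u\<close> and \<open>w\<close> become
    \<open>ab\<close> and \<open>cb\<close>; they bound the inner product at \<open>v\<close> by
    \<open>b * (1 - s - t)\<close>, which is not positive.\<close>
  define a b c where "a = u \<bullet> u" and "b = u \<bullet> w" and "c = w \<bullet> w"
  have ab: "t * b < a * (1 - s)"
    using assms(7) unfolding v(1) a_def b_def by (simp add: algebra_simps inner_add inner_diff)
  have cb: "s * b < c * (1 - t)"
    using assms(8) unfolding v(1) b_def c_def
    by (simp add: algebra_simps inner_add inner_diff inner_commute)
  have "(u - v) \<bullet> (w - v) =
      - (s * (a * (1 - s))) + ((1 - s) * (1 - t) + s * t) * b - t * (c * (1 - t))"
    unfolding v(1) a_def b_def c_def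
    by (simp add: algebra_simps inner_add inner_diff inner_commute)
  also have "\<dots> \<le> - (s * (t * b)) + ((1 - s) * (1 - t) + s * t) * b - t * (s * b)"
    using mult_left_mono[OF less_imp_le[OF ab] v(2)] mult_left_mono[OF less_imp_le[OF cb] v(3)]
    by linarith
  also have "\<dots> = b * (1 - s - t)" by (simp add: algebra_simps)
  also have "\<dots> \<le> 0" using False assms(4) by (simp add: b_def mult_le_0_iff)
  finally show False using assms(9) by simp
qed

text \<open>Three plane vectors satisfy a linear relation whose coefficients are 2x2 determinants.
  Since the inner products are positive, nonzero coefficients cannot all have the same weak sign, so
  one vector can be solved for with nonnegative coefficients.\<close>

lemma planar_nonneg_dependency:
  fixes u v w :: "real ^ 2"
  assumes "0 < u \<bullet> v" "0 < u \<bullet> w" "0 < v \<bullet> w"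
  shows "(\<exists>s t. 0 \<le> s \<and> 0 \<le> t \<and> v = s *\<^sub>R u + t *\<^sub>R w) \<or>
         (\<exists>s t. 0 \<le> s \<and> 0 \<le> t \<and> u = s *\<^sub>R v + t *\<^sub>R w) \<or>
         (\<exists>s t. 0 \<le> s \<and> 0 \<le> t \<and> w = s *\<^sub>R u + t *\<^sub>R v)"
proof -
  define A B C where "A = v $ 1 * w $ 2 - v $ 2 * w $ 1" and "B = w $ 1 * u $ 2 - w $ 2 * u $ 1"
    and "C = u $ 1 * v $ 2 - u $ 2 * v $ 1"
  have dep: "A *\<^sub>R u + B *\<^sub>R v + C *\<^sub>R w = 0"
    by (simp add: vec_eq_iff forall_2 A_def B_def C_def algebra_simps)
  have uu: "0 < u \<bullet> u" using assms(1) by (metis inner_gt_zero_iff inner_zero_left less_irrefl)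
  show ?thesis
  proof (cases "A = 0 \<and> B = 0 \<and> C = 0")
    case True
    have "v = ((u \<bullet> v) / (u \<bullet> u)) *\<^sub>R u + 0 *\<^sub>R w"
    proof -
      have "(u \<bullet> u) *\<^sub>R v = (u \<bullet> v) *\<^sub>R u"
        using True by (simp add: C_def vec_eq_iff forall_2 inner_vec_def sum_2 algebra_simps)
      then show ?thesis using uu by (simp add: vec_eq_iff field_simps)
    qed
    moreover have "0 \<le> (u \<bullet> v) / (u \<bullet> u)" using assms(1) uu by simp
    ultimately show ?thesis by blast
  next
    case nz: False
    have "(A *\<^sub>R u + B *\<^sub>R v + C *\<^sub>R w) \<bullet> u = 0" by (simp only: dep inner_zero_left)
    then have sum: "A * (u \<bullet> u) + B * (u \<bullet> v) + C * (u \<bullet> w) = 0"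
      by (simp only: inner_add_left inner_scaleR_left inner_commute[of v u] inner_commute[of w u])
    have "\<not> (0 \<le> A \<and> 0 \<le> B \<and> 0 \<le> C)"
    proof
      assume *: "0 \<le> A \<and> 0 \<le> B \<and> 0 \<le> C"
      then have "0 \<le> A * (u \<bullet> u)" "0 \<le> B * (u \<bullet> v)" "0 \<le> C * (u \<bullet> w)" using assms uu by auto
      then have "A * (u \<bullet> u) = 0" "B * (u \<bullet> v) = 0" "C * (u \<bullet> w) = 0" using sum by linarith+
      then show False using nz assms uu by auto
    qed
    moreover have "\<not> (A \<le> 0 \<and> B \<le> 0 \<and> C \<le> 0)"
    proof
      assume *: "A \<le> 0 \<and> B \<le> 0 \<and> C \<le> 0"
      then have "A * (u \<bullet> u) \<le> 0" "B * (u \<bullet> v) \<le> 0" "C * (u \<bullet> w) \<le> 0"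
        using assms uu by (auto simp: mult_le_0_iff)
      then have "A * (u \<bullet> u) = 0" "B * (u \<bullet> v) = 0" "C * (u \<bullet> w) = 0" using sum by linarith+
      then show False using nz assms uu by auto
    qed
    ultimately have "B \<noteq> 0 \<and> 0 \<le> - A / B \<and> 0 \<le> - C / B \<or>
        A \<noteq> 0 \<and> 0 \<le> - B / A \<and> 0 \<le> - C / A \<or> C \<noteq> 0 \<and> 0 \<le> - A / C \<and> 0 \<le> - B / C"
      unfolding zero_le_divide_iff by argo
    then consider
      "B \<noteq> 0" "0 \<le> - A / B" "0 \<le> - C / B" | "A \<noteq> 0" "0 \<le> - B / A" "0 \<le> - C / A" |
      "C \<noteq> 0" "0 \<le> - A / C" "0 \<le> - B / C"
      by blast
    then show ?thesis
    proof cases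
      case 1
      have "v = (- A / B) *\<^sub>R u + (- C / B) *\<^sub>R w"
        using dep 1 by (simp add: vec_eq_iff forall_2 field_simps)
      then show ?thesis using 1 by blast
    next
      case 2
      have "u = (- B / A) *\<^sub>R v + (- C / A) *\<^sub>R w"
        using dep 2 by (simp add: vec_eq_iff forall_2 field_simps)
      then show ?thesis using 2 by blast
    next
      case 3
      have "w = (- A / C) *\<^sub>R u + (- B / C) *\<^sub>R v"
        using dep 3 by (simp add: vec_eq_iff forall_2 field_simps)
      then show ?thesis using 3 by blast
    qed
  qed
qed

text \<open>The hypotheses say that all twelve angles among 0, \<open>u\<close>, \<open>v\<close>,
  \<open>w\<close> are acute. Whichever vector lies in the cone of the other two plays the part of
  \<open>v\<close> in \<open>acute_quadrilateral_False\<close>.\<close>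

lemma four_points_obtuse:
  fixes u v w :: "real ^ 2"
  assumes "0 < u \<bullet> v" "0 < u \<bullet> w" "0 < v \<bullet> w"
    and "0 < u \<bullet> (u - v)" "0 < u \<bullet> (u - w)" "0 < v \<bullet> (v - u)" "0 < v \<bullet> (v - w)"
    and "0 < w \<bullet> (w - u)" "0 < w \<bullet> (w - v)"
    and "0 < (u - v) \<bullet> (w - v)" "0 < (v - u) \<bullet> (w - u)" "0 < (u - w) \<bullet> (v - w)"
  shows False
  using planar_nonneg_dependency[OF assms(1-3)]
proof (elim disjE exE conjE)
  fix s t :: real assume "0 \<le> s" "0 \<le> t" "v = s *\<^sub>R u + t *\<^sub>R w"
  then show False
    using acute_quadrilateral_False[OF _ _ _ assms(2) assms(6) assms(7) assms(4) assms(9) assms(10)] by blast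
next
  fix s t :: real assume "0 \<le> s" "0 \<le> t" "u = s *\<^sub>R v + t *\<^sub>R w"
  then show False
    using acute_quadrilateral_False[OF _ _ _ assms(3) assms(4) assms(5) assms(6) assms(8) assms(11)] by blast
next
  fix s t :: real assume "0 \<le> s" "0 \<le> t" "w = s *\<^sub>R u + t *\<^sub>R v"
  then show False
    using acute_quadrilateral_False[OF _ _ _ assms(1) assms(8) assms(9) assms(5) assms(7) assms(12)] by blast
qed

lemma four_points_diameter:
  fixes N :: "real ^ 2 \<Rightarrow> real"
  assumes tri: "\<And>x y. N (x + y) \<le> N x + N y"
    and scale: "\<And>c x. N (c *\<^sub>R x) = \<bar>c\<bar> * N x"
    and rot: "\<And>x. N (rot x) = N x"
    and g: "\<And>x. g * N x \<le> N (x - rot x)" "0 \<le> g"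
    and min: "1 \<le> N u" "1 \<le> N v" "1 \<le> N w" "1 \<le> N (u - v)" "1 \<le> N (u - w)" "1 \<le> N (v - w)"
    and max: "N u \<le> M" "N v \<le> M" "N w \<le> M" "N (u - v) \<le> M" "N (u - w) \<le> M" "N (v - w) \<le> M"
  shows "g \<le> M"
proof (rule ccontr)
  assume "\<not> g \<le> M"
  then have lt: "M < g" by simp
  have neg: "N (- x) = N x" for x using scale[of "- 1" x] by simp
  have c: "N (a - b) = N (b - a)" for a b using neg[of "b - a"] unfolding minus_diff_eq .
  \<comment> \<open>Used for two sides leaving a common point: their difference is the third side of
    the triangle, too short for a non-acute angle.\<close>
  have "0 < x \<bullet> y" if "1 \<le> N x" "1 \<le> N y" "N (x - y) \<le> M" for x y
  proof (rule ccontr)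
    assume "\<not> 0 < x \<bullet> y"
    then have "x \<bullet> y \<le> 0" by simp
    then have "g \<le> N (x - y)"
      using norm_diff_obtuse[of N g x y, OF tri scale rot g] that by blast
    then show False using that lt by linarith
  qed
  note pos = this
  have min': "1 \<le> N (v - u)" "1 \<le> N (w - u)" "1 \<le> N (w - v)"
    using min by (simp_all only: c[of v u] c[of w u] c[of w v])
  show False
  proof (rule four_points_obtuse[of u v w]; rule pos)
    show "N (u - (u - v)) \<le> M" "N (u - (u - w)) \<le> M" "N (v - (v - u)) \<le> M"
      "N (v - (v - w)) \<le> M" "N (w - (w - u)) \<le> M" "N (w - (w - v)) \<le> M"
      "N (u - v - (w - v)) \<le> M" "N (v - u - (w - u)) \<le> M" "N (u - w - (v - w)) \<le> M"
      using max by simp_all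
  qed (fact min max min')+
qed

section \<open>The p-norm\<close>

lemma pnorm_ereal:
  "pnorm (ereal q) x = (\<Sum>i\<in>UNIV. \<bar>x $ i\<bar> powr q) powr (1 / q)"
  by (simp add: pnorm_def)

lemma pnorm_nonneg: "0 \<le> pnorm p x"
  by (simp add: pnorm_def infnorm_pos_le)

lemma pnorm_ereal_powr:
  "0 < q \<Longrightarrow> pnorm (ereal q) x powr q = (\<Sum>i\<in>UNIV. \<bar>x $ i\<bar> powr q)"
  by (simp add: pnorm_ereal powr_powr sum_nonneg)

lemma pnorm_ereal_scale:
  assumes "0 < q"
  shows "pnorm (ereal q) (c *\<^sub>R x) = \<bar>c\<bar> * pnorm (ereal q) x"
  using assms
  by (simp add: pnorm_ereal abs_mult powr_mult powr_powr sum_nonneg flip: sum_distrib_left)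

lemma pnorm_ereal_eq_0:
  assumes "0 < q" "pnorm (ereal q) x = 0"
  shows "x = 0"
  using assms by (simp add: pnorm_ereal sum_nonneg_eq_0_iff vec_eq_iff)

text \<open>Minkowski's inequality: divided by \<open>a + b\<close>, the sum is a convex
  combination, with weight \<open>t\<close>, of the normalised vectors, and convexity of the power
  is applied in every coordinate.\<close>

lemma pnorm_ereal_triangle:
  assumes q: "1 \<le> q"
  shows "pnorm (ereal q) (x + y) \<le> pnorm (ereal q) x + pnorm (ereal q) y"
proof (cases "pnorm (ereal q) x = 0 \<or> pnorm (ereal q) y = 0")
  case True
  then show ?thesis using pnorm_ereal_eq_0[of q] pnorm_nonneg[of "ereal q"] q by fastforce
next
  case False
  define a b t where "a = pnorm (ereal q) x" and "b = pnorm (ereal q) y" and "t = a / (a + b)"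
  have ab: "0 < a" "0 < b"
    using False pnorm_nonneg[of "ereal q"] by (auto simp: a_def b_def less_le)
  have t: "0 \<le> t" "t \<le> 1" "1 - t = b / (a + b)" using ab by (auto simp: t_def field_simps)
  have q0: "0 < q" using q by simp
  have coord: "\<bar>(x + y) $ i\<bar> powr q
      \<le> (a + b) powr q * (t * (\<bar>x $ i\<bar> powr q / a powr q) + (1 - t) * (\<bar>y $ i\<bar> powr q / b powr q))"
    for i
  proof -
    have "(a + b) * (t * (\<bar>x $ i\<bar> / a) + (1 - t) * (\<bar>y $ i\<bar> / b)) = \<bar>x $ i\<bar> + \<bar>y $ i\<bar>"
    proof -
      have "(a + b) * t = a" "(a + b) * (1 - t) = b" unfolding t(3) using ab by (simp_all add: t_def)
      then have "(a + b) * t * (\<bar>x $ i\<bar> / a) + (a + b) * (1 - t) * (\<bar>y $ i\<bar> / b) = \<bar>x $ i\<bar> + \<bar>y $ i\<bar>"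
        using ab by simp
      then show ?thesis by (simp only: distrib_left mult.assoc)
    qed
    then have "\<bar>(x + y) $ i\<bar> \<le> (a + b) * (t * (\<bar>x $ i\<bar> / a) + (1 - t) * (\<bar>y $ i\<bar> / b))"
      by simp
    then have "\<bar>(x + y) $ i\<bar> powr q
        \<le> ((a + b) * (t * (\<bar>x $ i\<bar> / a) + (1 - t) * (\<bar>y $ i\<bar> / b))) powr q"
      using q by (intro powr_mono2) auto
    also have "\<dots> = (a + b) powr q * (t * (\<bar>x $ i\<bar> / a) + (1 - t) * (\<bar>y $ i\<bar> / b)) powr q"
      using ab t by (simp add: powr_mult)
    also have "\<dots> \<le> (a + b) powr q *
        (t * (\<bar>x $ i\<bar> / a) powr q + (1 - t) * (\<bar>y $ i\<bar> / b) powr q)"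
      using ab t by (intro mult_left_mono powr_convex_nonneg[OF q]) auto
    also have "\<dots> = (a + b) powr q *
        (t * (\<bar>x $ i\<bar> powr q / a powr q) + (1 - t) * (\<bar>y $ i\<bar> powr q / b powr q))"
      using ab by (simp add: powr_divide)
    finally show ?thesis .
  qed
  have "pnorm (ereal q) (x + y) powr q \<le> (\<Sum>i\<in>UNIV. (a + b) powr q *
      (t * (\<bar>x $ i\<bar> powr q / a powr q) + (1 - t) * (\<bar>y $ i\<bar> powr q / b powr q)))"
    unfolding pnorm_ereal_powr[OF q0] by (intro sum_mono coord)
  also have "\<dots> = (a + b) powr q *
      (t * (pnorm (ereal q) x powr q / a powr q) + (1 - t) * (pnorm (ereal q) y powr q / b powr q))"
    unfolding pnorm_ereal_powr[OF q0]
    by (simp add: sum.distrib flip: sum_distrib_left sum_divide_distrib)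
  also have "\<dots> = (a + b) powr q" using ab by (simp add: a_def b_def)
  finally show ?thesis
    using powr_le_cancel_iff ab q0 pnorm_nonneg[of "ereal q" "x + y"] powr_less_mono2[of q "a + b" "pnorm (ereal q) (x + y)"]
    by (force simp: a_def b_def not_le[symmetric])
qed

lemma pnorm_ereal_rot: "pnorm (ereal q) (rot x) = pnorm (ereal q) x"
  by (simp add: pnorm_ereal rot_def sum_2 add.commute)

text \<open>The coordinates of \<open>x - rot x\<close> are the sum and, up to sign, the difference
  of those of \<open>x\<close>, so this is Clarkson's inequality after taking \<open>q\<close>-th
  roots; \<open>c\<close> is \<open>g powr q\<close>.\<close>

lemma pnorm_ereal_diff_rot:
  fixes q :: real
  defines "g \<equiv> (if q \<le> 2 then 2 powr (1 - 1 / q) else 2 powr (1 / q))"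
  assumes q: "1 \<le> q"
  shows "g * pnorm (ereal q) x \<le> pnorm (ereal q) (x - rot x)"
proof -
  define c where "c = (if q \<le> 2 then 2 powr (q - 1) else (2::real))"
  have "c \<ge> 0" by (simp add: c_def)
  have g: "g = c powr (1 / q)"
    using q by (simp add: g_def c_def powr_powr diff_divide_distrib)
  have eq: "\<bar>x $ 1 - x $ 2\<bar> = \<bar>x $ 2 - x $ 1\<bar>" by simp
  have "c * (\<bar>x $ 1\<bar> powr q + \<bar>x $ 2\<bar> powr q)
      \<le> \<bar>x $ 1 + x $ 2\<bar> powr q + \<bar>x $ 1 - x $ 2\<bar> powr q"
    using clarkson_ge_2[of q "x $ 1" "x $ 2"] clarkson_dual[of q "x $ 1" "x $ 2"] q
    by (simp add: c_def)
  then have "(c * (\<bar>x $ 1\<bar> powr q + \<bar>x $ 2\<bar> powr q)) powr (1 / q)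
      \<le> (\<bar>x $ 1 + x $ 2\<bar> powr q + \<bar>x $ 1 - x $ 2\<bar> powr q) powr (1 / q)"
    using q \<open>c \<ge> 0\<close> by (intro powr_mono2) auto
  then show ?thesis
    using q \<open>c \<ge> 0\<close> by (simp add: pnorm_ereal rot_def sum_2 g powr_mult eq)
qed

section \<open>Integer flows\<close>

text \<open>With all arcs in one sum, conservation can be stated by incidence vectors, and sums over
  arcs and vertices can be exchanged.\<close>

lemma flow_conservation_iff:
  assumes "finite (arcs D)"
  shows "flow_conservation D f \<longleftrightarrow>
    (\<forall>v\<in>verts D. (\<Sum>e\<in>arcs D. (if tail D e = v then f e else 0) - (if head D e = v then f e else 0)) = 0)"
  using assms
  by (simp add: flow_conservation_def out_arcs_def in_arcs_def sum_subtractf sum.inter_filter)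

text \<open>
  Splitting off: two edges meeting at a common vertex are replaced by one edge joining their
  other ends. Representing each edge by its incidence vector, this adds up two such vectors
  after adjusting the sign of one of them.
\<close>

lemma even_signing:
  fixes d :: "'e \<Rightarrow> 'v \<Rightarrow> int"
  assumes "finite A"
    and "\<And>e. e \<in> A \<Longrightarrow> \<exists>a b. d e = (\<lambda>v. of_bool (v = a) - of_bool (v = b))"
    and "\<And>v. even (\<Sum>e\<in>A. d e v)"
  shows "\<exists>\<sigma>. (\<forall>e\<in>A. \<sigma> e \<in> {- 1, 1}) \<and> (\<forall>v. (\<Sum>e\<in>A. \<sigma> e * d e v) = 0)"
  using assms
proof (induction "card A" arbitrary: A d)
  case 0
  then show ?case by auto
next
  case (Suc n)
  then obtain e where e: "e \<in> A" by (metis card.empty ex_in_conv nat.distinct(1))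
  obtain a b where de: "d e = (\<lambda>v. of_bool (v = a) - of_bool (v = b))" using Suc.prems(2)[OF e] by blast
  have rem: "(\<Sum>x\<in>A. k x) = k y + (\<Sum>x\<in>A - {y}. k x)" if "y \<in> A" for k :: "'e \<Rightarrow> int" and y
    using Suc.prems(1) that by (rule sum.remove)
  have card: "n = card (A - {y})" if "y \<in> A" for y using Suc.hyps(2) Suc.prems(1) that by simp
  show ?case
  proof (cases "a = b")
    case True
    \<comment> \<open>Splitting off can create a loop; its vector is zero, so either sign will
      do.\<close>
    then have "d e v = 0" for v using de by simp
    then have *: "(\<Sum>x\<in>A. s x * d x v) = (\<Sum>x\<in>A - {e}. s x * d x v)" for s v
      using rem[OF e, of "\<lambda>x. s x * d x v"] by simp
    have "even (\<Sum>x\<in>A - {e}. d x v)" for v using Suc.prems(3)[of v] *[of "\<lambda>_. 1" v] by simp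
    then obtain \<sigma> where \<sigma>: "\<forall>x\<in>A - {e}. \<sigma> x \<in> {- 1, 1}" "\<forall>v. (\<Sum>x\<in>A - {e}. \<sigma> x * d x v) = 0"
      using Suc.hyps(1)[OF card[OF e], of d] Suc.prems(1,2) by auto
    have "(\<Sum>x\<in>A. (\<sigma>(e := 1)) x * d x v) = 0" for v
    proof -
      have "(\<Sum>x\<in>A - {e}. (\<sigma>(e := 1)) x * d x v) = (\<Sum>x\<in>A - {e}. \<sigma> x * d x v)"
        by (intro sum.cong) auto
      then show ?thesis using \<sigma>(2) by (simp only: *)
    qed
    moreover have "\<forall>x\<in>A. (\<sigma>(e := 1)) x \<in> {- 1, 1}" using \<sigma>(1) by auto
    ultimately show ?thesis by blast
  next
    case False
    \<comment> \<open>\<open>e\<close> contributes -1 at \<open>b\<close>, so by parity some other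
      edge has an odd entry there.\<close>
    have "\<exists>e'\<in>A - {e}. odd (d e' b)"
    proof (rule ccontr)
      assume "\<not> ?thesis"
      then have "even (\<Sum>x\<in>A - {e}. d x b)" by (intro dvd_sum) auto
      then show False using Suc.prems(3)[of b] rem[OF e, of "\<lambda>x. d x b"] de False by simp
    qed
    then obtain e' where e': "e' \<in> A" "e' \<noteq> e" "odd (d e' b)" by blast
    obtain p q where de': "d e' = (\<lambda>v. of_bool (v = p) - of_bool (v = q))"
      using Suc.prems(2)[OF e'(1)] by blast
    \<comment> \<open>The sign with which \<open>e'\<close> cancels \<open>e\<close> at
      \<open>b\<close>, paired with the other end of \<open>e'\<close>.\<close>
    define s :: "int \<times> 'v" where "s = (if p = b then (1, q) else (- 1, p))"
    have s: "fst s = 1 \<or> fst s = - 1" by (simp add: s_def)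
    have split: "d e v + fst s * d e' v = of_bool (v = a) - of_bool (v = snd s)" for v
      using e'(3) by (auto simp: s_def de de' split: if_splits)
    define d' where "d' = d(e := (\<lambda>v. d e v + fst s * d e' v))"
    have sum': "(\<Sum>x\<in>A - {e'}. \<tau> x * d' x v) = (\<Sum>x\<in>A - {e'}. \<tau> x * d x v) + \<tau> e * fst s * d e' v"
      for \<tau> v
    proof -
      have "(\<Sum>x\<in>A - {e'}. \<tau> x * d' x v)
          = (\<Sum>x\<in>A - {e'}. \<tau> x * d x v + (if x = e then \<tau> e * fst s * d e' v else 0))"
        by (intro sum.cong) (auto simp: d'_def algebra_simps)
      also have "\<dots> = (\<Sum>x\<in>A - {e'}. \<tau> x * d x v) + \<tau> e * fst s * d e' v"
        using e e' Suc.prems(1) by (simp add: sum.distrib)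
      finally show ?thesis .
    qed
    have "even (\<Sum>x\<in>A - {e'}. d' x v)" for v
    proof -
      have "(\<Sum>x\<in>A - {e'}. d' x v) = (\<Sum>x\<in>A. d x v) - d e' v + fst s * d e' v"
        using sum'[of "\<lambda>_. 1" v] rem[OF e'(1), of "\<lambda>x. d x v"] by simp
      then show ?thesis using Suc.prems(3)[of v] s by auto
    qed
    moreover have "\<exists>a b. d' x = (\<lambda>v. of_bool (v = a) - of_bool (v = b))" if "x \<in> A - {e'}" for x
      using Suc.prems(2)[of x] that split by (auto simp: d'_def)
    ultimately obtain \<sigma> where \<sigma>: "\<forall>x\<in>A - {e'}. \<sigma> x \<in> {- 1, 1}"
        "\<forall>v. (\<Sum>x\<in>A - {e'}. \<sigma> x * d' x v) = 0"
      using Suc.hyps(1)[OF card[OF e'(1)], of d'] Suc.prems(1) by auto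
    \<comment> \<open>The merged edge stands for \<open>d e + fst s * d e'\<close>, so its sign is
      passed on to both edges.\<close>
    define \<sigma>' where "\<sigma>' = \<sigma>(e' := \<sigma> e * fst s)"
    have "(\<Sum>x\<in>A. \<sigma>' x * d x v) = 0" for v
    proof -
      have "(\<Sum>x\<in>A. \<sigma>' x * d x v) = \<sigma> e * fst s * d e' v + (\<Sum>x\<in>A - {e'}. \<sigma>' x * d x v)"
        by (simp add: rem[OF e'(1)] \<sigma>'_def)
      also have "(\<Sum>x\<in>A - {e'}. \<sigma>' x * d x v) = (\<Sum>x\<in>A - {e'}. \<sigma> x * d x v)"
        by (intro sum.cong) (auto simp: \<sigma>'_def)
      finally show ?thesis using \<sigma>(2) sum'[of \<sigma> v] by simp
    qed
    moreover have "\<forall>x\<in>A. \<sigma>' x \<in> {- 1, 1}" using \<sigma>(1) e e' s by (auto simp: \<sigma>'_def)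
    ultimately show ?thesis by blast
  qed
qed

lemma orientation_ends:
  assumes "finite_loopless G" "is_orientation G D" "e \<in> edges G"
  shows "tail D e \<in> vertices G" "head D e \<in> vertices G"
  using assms by (auto simp: finite_loopless_def is_orientation_def)

lemma orientation_finite_arcs:
  "finite_loopless G \<Longrightarrow> is_orientation G D \<Longrightarrow> finite (arcs D)"
  by (simp add: finite_loopless_def is_orientation_def)

text \<open>Modulo 2, \<open>f\<close> is the indicator of its odd edges, so conservation of
  \<open>f\<close> makes the incidence vectors of these edges sum to an even vector. The signs from
  \<open>even_signing\<close> are then the values of \<open>g\<close>.\<close>

lemma flow_odd_support:
  fixes f :: "'e \<Rightarrow> int"
  assumes G: "finite_loopless G" and D: "is_orientation G D" and f: "flow_conservation D f"
  shows "\<exists>g. flow_conservation D g \<and> (\<forall>e\<in>edges G. odd (f e) \<longrightarrow> g e \<in> {- 1, 1 :: int}) \<and>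
    (\<forall>e. even (f e) \<longrightarrow> g e = 0)"
proof -
  have arcs: "arcs D = edges G" and verts: "verts D = vertices G"
    using D by (auto simp: is_orientation_def)
  have fin: "finite (arcs D)" by (rule orientation_finite_arcs[OF G D])
  define d where "d e v = (of_bool (v = tail D e) - of_bool (v = head D e) :: int)" for e v
  have flow: "flow_conservation D k \<longleftrightarrow> (\<forall>v\<in>verts D. (\<Sum>e\<in>arcs D. k e * d e v) = 0)"
    for k :: "'e \<Rightarrow> int"
  proof -
    have "(if tail D e = v then k e else 0) - (if head D e = v then k e else 0) = k e * d e v" for e v
      by (auto simp: d_def)
    then show ?thesis by (simp add: flow_conservation_iff[OF fin])
  qed
  define A where "A = {e \<in> arcs D. odd (f e)}"
  have "finite A" using fin by (simp add: A_def)
  have "even (\<Sum>e\<in>A. d e v)" for v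
  proof (cases "v \<in> verts D")
    case True
    have "(\<Sum>e\<in>A. d e v) = (\<Sum>e\<in>arcs D. (if odd (f e) then d e v else 0))"
      using fin by (simp add: A_def sum.inter_filter)
    moreover have "even ((\<Sum>e\<in>arcs D. (if odd (f e) then d e v else 0)) - (\<Sum>e\<in>arcs D. f e * d e v))"
      unfolding sum_subtractf[symmetric] by (intro dvd_sum) auto
    ultimately show ?thesis using f True by (simp add: flow)
  next
    case False
    then have "d e v = 0" if "e \<in> A" for e
      using that orientation_ends[OF G D, of e] by (auto simp: d_def A_def arcs verts)
    then show ?thesis by simp
  qed
  moreover have "\<exists>a b. d e = (\<lambda>v. of_bool (v = a) - of_bool (v = b))" for e
  proof -
    have "d e = (\<lambda>v. of_bool (v = tail D e) - of_bool (v = head D e))" by (simp add: d_def fun_eq_iff)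
    then show ?thesis by blast
  qed
  ultimately obtain \<sigma> where \<sigma>: "\<forall>e\<in>A. \<sigma> e \<in> {- 1, 1}" "\<forall>v. (\<Sum>e\<in>A. \<sigma> e * d e v) = 0"
    using even_signing[OF \<open>finite A\<close>, of d] by blast
  define g where "g e = (if odd (f e) then \<sigma> e else 0)" for e
  have "(\<Sum>e\<in>arcs D. g e * d e v) = (\<Sum>e\<in>A. \<sigma> e * d e v)" for v
    unfolding A_def sum.inter_filter[OF fin] by (intro sum.cong) (auto simp: g_def)
  then have "flow_conservation D g" using \<sigma>(2) by (simp add: flow)
  then show ?thesis using \<sigma>(1) by (intro exI[of _ g]) (auto simp: g_def A_def arcs)
qed

text \<open>\<open>g\<close> lives on the odd edges of \<open>f\<close>, and \<open>h\<close> on the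
  odd edges of \<open>k\<close>, which is half of \<open>f + g\<close>. Where \<open>g\<close>
  vanishes, \<open>f\<close> is 2 or -2, so \<open>k\<close> is odd and \<open>h\<close> is
  nonzero.\<close>

lemma four_flow_pair:
  fixes G :: "('v, 'e) multigraph"
  assumes G: "finite_loopless G" and "admits_NZF 4 G"
  obtains D g h where "is_orientation G D" "flow_conservation D g" "flow_conservation D h"
    "\<And>e. e \<in> edges G \<Longrightarrow> g e \<in> {- 1, 0, 1 :: int} \<and> h e \<in> {- 1, 0, 1 :: int} \<and> (g e \<noteq> 0 \<or> h e \<noteq> 0)"
proof -
  obtain D and f :: "'e \<Rightarrow> int" where D: "is_orientation G D" and f: "flow_conservation D f"
    and nz: "\<forall>e\<in>edges G. 0 < \<bar>f e\<bar> \<and> \<bar>f e\<bar> < (4 :: int)"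
    using assms(2) by (auto simp: admits_NZF_def is_NZF_def)
  have arcs: "arcs D = edges G" using D by (simp add: is_orientation_def)
  obtain g :: "'e \<Rightarrow> int" where g: "flow_conservation D g"
      "\<And>e. e \<in> edges G \<Longrightarrow> odd (f e) \<Longrightarrow> g e \<in> {- 1, 1}"
      "\<And>e. even (f e) \<Longrightarrow> g e = 0"
    using flow_odd_support[OF G D f] by auto
  define k where "k e = (f e + g e) div 2" for e
  have k: "2 * k e = f e + g e" if "e \<in> edges G" for e
  proof -
    have "even (f e + g e)" using g(2)[OF that] g(3)[of e] by (cases "even (f e)") auto
    then show ?thesis by (simp add: k_def)
  qed
  have "flow_conservation D k"
    unfolding flow_conservation_def
  proof
    fix v assume v: "v \<in> verts D"
    have two: "2 * (\<Sum>e\<in>B. k e) = (\<Sum>e\<in>B. f e) + (\<Sum>e\<in>B. g e)" if "B \<subseteq> arcs D" for B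
      unfolding sum_distrib_left sum.distrib[symmetric] by (intro sum.cong) (use that k arcs in auto)
    have "2 * (\<Sum>e\<in>out_arcs D v. k e) - 2 * (\<Sum>e\<in>in_arcs D v. k e) = 0"
      using f g(1) v by (subst (1 2) two) (auto simp: flow_conservation_def out_arcs_def in_arcs_def)
    then show "(\<Sum>e\<in>out_arcs D v. k e) - (\<Sum>e\<in>in_arcs D v. k e) = 0" by simp
  qed
  then obtain h :: "'e \<Rightarrow> int" where h: "flow_conservation D h"
      "\<And>e. e \<in> edges G \<Longrightarrow> odd (k e) \<Longrightarrow> h e \<in> {- 1, 1}" "\<And>e. even (k e) \<Longrightarrow> h e = 0"
    using flow_odd_support[OF G D, of k] by auto
  have "g e \<in> {- 1, 0, 1} \<and> h e \<in> {- 1, 0, 1} \<and> (g e \<noteq> 0 \<or> h e \<noteq> 0)" if e: "e \<in> edges G" for e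
  proof -
    have "h e \<in> {- 1, 0, 1}" using h(2)[OF e] h(3)[of e] by auto
    moreover have "odd (k e)" if "even (f e)"
    proof -
      have "f e \<in> {- 2, 2}" using bspec[OF nz e] that by (simp add: insert_iff) presburger
      then show ?thesis using g(3)[OF that] by (auto simp: k_def)
    qed
    ultimately show ?thesis using g(2)[OF e] g(3)[of e] h(2)[OF e] by fastforce
  qed
  then show thesis using that D g(1) h(1) by blast
qed

lemma flow_conservation_scaleR_add:
  fixes a b :: "'a::real_vector" and g h :: "'e \<Rightarrow> int"
  assumes "flow_conservation D g" "flow_conservation D h"
  shows "flow_conservation D (\<lambda>e. of_int (g e) *\<^sub>R a + of_int (h e) *\<^sub>R b)"
  unfolding flow_conservation_def
proof
  fix v assume v: "v \<in> verts D"
  have *: "(\<Sum>e\<in>B. of_int (g e) *\<^sub>R a + of_int (h e) *\<^sub>R b)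
      = of_int (\<Sum>e\<in>B. g e) *\<^sub>R a + of_int (\<Sum>e\<in>B. h e) *\<^sub>R b" for B
    by (simp add: sum.distrib scaleR_sum_left)
  show "(\<Sum>e\<in>out_arcs D v. of_int (g e) *\<^sub>R a + of_int (h e) *\<^sub>R b)
      - (\<Sum>e\<in>in_arcs D v. of_int (g e) *\<^sub>R a + of_int (h e) *\<^sub>R b) = 0"
    using assms v unfolding * by (simp add: flow_conservation_def)
qed

section \<open>Bounds on the flow index\<close>

lemma phi_ge_2: "2 \<le> phi TYPE('d::finite) p G"
  unfolding phi_def by (intro Inf_greatest) (auto simp: is_vector_NZF_def)

lemma pnorm_zero: "p \<noteq> 0 \<Longrightarrow> pnorm p 0 = 0"
  by (simp add: pnorm_def infnorm_0)

lemma pnorm_minus: "pnorm p (- x) = pnorm p x"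
  by (simp add: pnorm_def infnorm_neg)

section \<open>Upper bounds from nowhere-zero 4-flows\<close>

text \<open>Combining the integer flows of \<open>four_flow_pair\<close> with coefficients
  \<open>a\<close> and \<open>b\<close> gives a flow whose values are, up to sign, \<open>a\<close>,
  \<open>b\<close>, \<open>a + b\<close> and \<open>a - b\<close>. The choice of \<open>a\<close>
  and \<open>b\<close> is left to the range of \<open>p\<close>.\<close>

lemma phi_le_of_four_flow:
  fixes G :: "('v, 'e) multigraph" and a b :: "real ^ 'd::finite"
  assumes G: "finite_loopless G" "admits_NZF 4 G" and "p \<noteq> 0" "1 \<le> R"
    and ab: "pnorm p a \<in> {1..R}" "pnorm p b \<in> {1..R}"
      "pnorm p (a + b) \<in> {1..R}" "pnorm p (a - b) \<in> {1..R}"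
  shows "phi TYPE('d) p G \<le> ereal (1 + R)"
proof -
  obtain D g h where D: "is_orientation G D" "flow_conservation D g" "flow_conservation D h"
    and gh: "\<And>e. e \<in> edges G \<Longrightarrow>
      g e \<in> {- 1, 0, 1 :: int} \<and> h e \<in> {- 1, 0, 1 :: int} \<and> (g e \<noteq> 0 \<or> h e \<noteq> 0)"
    by (rule four_flow_pair[OF G]) blast
  define F where "F e = of_int (g e) *\<^sub>R a + of_int (h e) *\<^sub>R b" for e
  have F: "pnorm p (F e) \<in> {1..R}" if "e \<in> edges G" for e
  proof -
    have "F e \<in> {a, b, a + b, a - b, - a, - b, - (a + b), - (a - b)}"
      using gh[OF that] by (auto simp: F_def)
    then show ?thesis using ab by (auto simp only: insert_iff empty_iff pnorm_minus)
  qed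
  have "F e \<noteq> 0" if "e \<in> edges G" for e
    using F[OF that] pnorm_zero[OF \<open>p \<noteq> 0\<close>, where 'a = 'd] by auto
  moreover have "flow_conservation D F"
    unfolding F_def by (rule flow_conservation_scaleR_add[OF D(2,3)])
  ultimately have "is_vector_NZF (1 + R) p G D F"
    using F D(1) \<open>1 \<le> R\<close> by (auto simp: is_vector_NZF_def is_vector_flow_def)
  then show ?thesis unfolding phi_def by (intro Inf_lower) blast
qed

lemma phi_le_powr_inverse:
  fixes G :: "('v, 'e) multigraph"
  assumes G: "finite_loopless G" "admits_NZF 4 G" and p: "1 \<le> p"
  shows "phi TYPE(2) p G \<le> ereal (1 + 2 powr real_of_ereal (1 / p))"
proof (rule phi_le_of_four_flow[OF G, where a = "vector [1, 0]" and b = "vector [0, 1]"])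
  show "p \<noteq> 0" using p by auto
  show "1 \<le> 2 powr real_of_ereal (1 / p)"
    using p by (cases p) (auto simp: one_ereal_def intro!: ge_one_powr_ge_zero)
  then show "pnorm p (vector [1, 0] :: real ^ 2) \<in> {1..2 powr real_of_ereal (1 / p)}"
    "pnorm p (vector [0, 1] :: real ^ 2) \<in> {1..2 powr real_of_ereal (1 / p)}"
    "pnorm p (vector [1, 0] + vector [0, 1] :: real ^ 2) \<in> {1..2 powr real_of_ereal (1 / p)}"
    "pnorm p (vector [1, 0] - vector [0, 1] :: real ^ 2) \<in> {1..2 powr real_of_ereal (1 / p)}"
    using p by (cases p; auto simp: pnorm_def infnorm_2 sum_2 one_ereal_def)+
qed

lemma phi_le_powr_conjugate:
  fixes G :: "('v, 'e) multigraph"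
  assumes G: "finite_loopless G" "admits_NZF 4 G" and p: "1 \<le> p" "p \<le> 2"
  shows "phi TYPE(2) p G \<le> ereal (1 + 2 powr (1 - real_of_ereal (1 / p)))"
proof -
  obtain q where q: "p = ereal q" "1 \<le> q" using p by (cases p) auto
  \<comment> \<open>Chosen so that \<open>a\<close> and \<open>b\<close> have norm 1;
    \<open>a + b\<close> and \<open>a - b\<close> lie on the axes, with norm
    \<open>2 * c\<close>.\<close>
  define c where "c = (2::real) powr (- 1 / q)"
  define a b :: "real ^ 2" where "a = vector [c, c]" and "b = vector [c, - c]"
  have "c powr q = 2 powr (- 1)" using q by (simp add: c_def powr_powr)
  then have c: "0 < c" "2 * c powr q = 1" by (simp_all add: c_def powr_minus)
  have n1: "pnorm p a = 1" "pnorm p b = 1"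
    using q c by (simp_all add: pnorm_ereal a_def b_def sum_2)
  have n2: "pnorm p (a + b) = 2 * c" "pnorm p (a - b) = 2 * c"
    using q c by (simp_all add: pnorm_ereal a_def b_def sum_2 powr_powr)
  have "2 * c = 2 powr (1 - real_of_ereal (1 / p))"
    using q by (simp add: c_def powr_diff powr_minus divide_inverse one_ereal_def)
  moreover have "1 \<le> 2 powr (1 - real_of_ereal (1 / p))"
    using q by (auto simp: one_ereal_def intro!: ge_one_powr_ge_zero)
  ultimately show ?thesis
    using p n1 n2 by (intro phi_le_of_four_flow[OF G, where a = a and b = b]) auto
qed

section \<open>Contraction to \<open>K4\<close>\<close>

text \<open>A whole sequence of identifications as one map on vertices. Edges keep their names, and
  the deleted ones are those that the map collapses.\<close>

definition quotient_map ::
    "('v \<Rightarrow> 'w) \<Rightarrow> ('v, 'e) multigraph \<Rightarrow> ('w, 'e) multigraph \<Rightarrow> bool" where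
  "quotient_map \<pi> G H \<longleftrightarrow> vertices H = \<pi> ` vertices G \<and> edges H \<subseteq> edges G \<and>
    (\<forall>e\<in>edges H. ends H e = \<pi> ` ends G e) \<and> (\<forall>e\<in>edges G - edges H. \<exists>x. \<pi> ` ends G e \<subseteq> {x})"

lemma quotient_mapD:
  assumes "quotient_map \<pi> G H"
  shows "vertices H = \<pi> ` vertices G" "edges H \<subseteq> edges G"
    "e \<in> edges H \<Longrightarrow> ends H e = \<pi> ` ends G e"
    "e \<in> edges G - edges H \<Longrightarrow> \<exists>x. \<pi> ` ends G e \<subseteq> {x}"
  using assms unfolding quotient_map_def by simp_all

lemma identification_steps_quotient:
  assumes "identification_step\<^sup>*\<^sup>* G H"
  shows "\<exists>\<pi>. quotient_map \<pi> G H"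
  using assms
proof (induction rule: rtranclp_induct)
  case base
  have "quotient_map id G G" by (simp add: quotient_map_def)
  then show ?case by blast
next
  case (step H H')
  from step.IH obtain \<pi> where "quotient_map \<pi> G H" by (rule exE)
  note \<pi> = quotient_mapD[OF this]
  obtain u v where H': "H' = identify u v H" using step(2) by (auto simp: identification_step_def)
  let ?\<rho> = "id(v := u) \<circ> \<pi>"
  have "\<exists>x. ?\<rho> ` ends G e \<subseteq> {x}" if e: "e \<in> edges G - edges H'" for e
  proof (cases "e \<in> edges H")
    case True
    then have "\<pi> ` ends G e = {u, v}" using e \<pi>(3) by (auto simp: H' identify_def)
    then show ?thesis unfolding image_comp[symmetric] by auto
  next
    case False
    then have "\<exists>x. \<pi> ` ends G e \<subseteq> {x}" using e \<pi>(4) by simp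
    then obtain x where "\<pi> ` ends G e \<subseteq> {x}" by (rule exE)
    then show ?thesis unfolding image_comp[symmetric] by (intro exI[of _ "(id(v := u)) x"]) blast
  qed
  moreover have "vertices H' = ?\<rho> ` vertices G" "edges H' \<subseteq> edges G"
    using \<pi>(1,2) by (auto simp: H' identify_def image_comp)
  moreover have "ends H' e = ?\<rho> ` ends G e" if "e \<in> edges H'" for e
  proof -
    have "e \<in> edges H" "ends H' e = id(v := u) ` ends H e" using that by (simp_all add: H' identify_def)
    then show ?thesis by (simp only: \<pi>(3) image_comp)
  qed
  ultimately have "quotient_map ?\<rho> G H'" by (simp add: quotient_map_def)
  then show ?case by blast
qed

text \<open>The classes come from the quotient map followed by the isomorphism. Uniqueness concerns
  all edges of \<open>G\<close>: an edge deleted on the way lies within one class, and \<beta>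
  separates the surviving ones.\<close>

lemma contractible_K4_partition:
  assumes "contractible_to G K4"
  obtains \<pi> where "\<pi> ` vertices G \<subseteq> {..<4::nat}"
    "\<And>i j. i < 4 \<Longrightarrow> j < 4 \<Longrightarrow> i \<noteq> j \<Longrightarrow> \<exists>!e. e \<in> edges G \<and> \<pi> ` ends G e = {i, j}"
proof -
  obtain H where H: "identification_step\<^sup>*\<^sup>* G H" "isomorphic H K4"
    using assms by (auto simp: contractible_to_def)
  obtain \<pi> where "quotient_map \<pi> G H" using identification_steps_quotient[OF H(1)] by (rule exE)
  note \<pi> = quotient_mapD[OF this]
  obtain \<alpha> \<beta> where ab: "bij_betw \<alpha> (vertices H) {0..<4::nat}"
    "bij_betw \<beta> (edges H) {e. e \<subseteq> {0..<4} \<and> card e = 2}"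
    "\<And>e. e \<in> edges H \<Longrightarrow> \<beta> e = \<alpha> ` ends H e"
    using H(2) by (auto simp: isomorphic_def K4_def)
  have img: "\<beta> e = (\<alpha> \<circ> \<pi>) ` ends G e" if "e \<in> edges H" for e
    using ab(3)[OF that] \<pi>(3)[OF that] by (simp add: image_comp)
  have "\<exists>!e. e \<in> edges G \<and> (\<alpha> \<circ> \<pi>) ` ends G e = {i, j}" if ij: "i < 4" "j < 4" "i \<noteq> j" for i j
  proof -
    have "{i, j} \<in> {e. e \<subseteq> {0..<4} \<and> card e = 2}" using ij by auto
    then have "{i, j} \<in> \<beta> ` edges H" by (simp only: bij_betw_imp_surj_on[OF ab(2)])
    then obtain e where e: "{i, j} = \<beta> e" "e \<in> edges H" by (rule imageE)
    show ?thesis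
    proof (rule ex1I)
      show "e \<in> edges G \<and> (\<alpha> \<circ> \<pi>) ` ends G e = {i, j}" using e img \<pi>(2) by auto
      fix e' assume e': "e' \<in> edges G \<and> (\<alpha> \<circ> \<pi>) ` ends G e' = {i, j}"
      have "e' \<in> edges H"
      proof (rule ccontr)
        assume "e' \<notin> edges H"
        then have "\<exists>x. \<pi> ` ends G e' \<subseteq> {x}" using e' \<pi>(4) by simp
        then obtain x where "\<pi> ` ends G e' \<subseteq> {x}" by (rule exE)
        then have "(\<alpha> \<circ> \<pi>) ` ends G e' \<subseteq> {\<alpha> x}" unfolding image_comp[symmetric] by blast
        then show False using e' ij by auto
      qed
      moreover from this have "\<beta> e' = \<beta> e" using e e' img by simp
      ultimately show "e' = e" using bij_betw_imp_inj_on[OF ab(2)] by (simp add: inj_on_eq_iff e(2))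
    qed
  qed
  moreover have "(\<alpha> \<circ> \<pi>) ` vertices G \<subseteq> {..<4}"
    using ab(1) \<pi>(1) by (auto simp: bij_betw_def lessThan_atLeast0 image_comp)
  ultimately show thesis by (rule that[rotated])
qed

section \<open>Flows between vertex classes\<close>

text \<open>Arcs from \<open>j\<close> to \<open>i\<close> count negatively, so the value is
  antisymmetric and vanishes for \<open>i = j\<close>, whatever the orientation.\<close>

definition class_flow ::
    "('v, 'e) pre_digraph \<Rightarrow> ('v \<Rightarrow> 'i) \<Rightarrow> ('e \<Rightarrow> 'a::ab_group_add) \<Rightarrow> 'i \<Rightarrow> 'i \<Rightarrow> 'a" where
  "class_flow D \<pi> f i j = (\<Sum>e\<in>arcs D.
     (if \<pi> (tail D e) = i \<and> \<pi> (head D e) = j then f e else 0) -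
     (if \<pi> (tail D e) = j \<and> \<pi> (head D e) = i then f e else 0))"

lemma class_flow_antisym: "class_flow D \<pi> f j i = - class_flow D \<pi> f i j"
  unfolding class_flow_def sum_negf[symmetric] by (simp only: minus_diff_eq)

text \<open>Conservation is summed over all vertices of class \<open>i\<close>; arcs with both ends
  in the class cancel.\<close>

lemma class_flow_conservation:
  assumes fin: "finite (arcs D)" "finite (verts D)" "finite I"
    and ends: "\<And>e. e \<in> arcs D \<Longrightarrow> tail D e \<in> verts D \<and> head D e \<in> verts D"
    and \<pi>: "\<pi> ` verts D \<subseteq> I" and f: "flow_conservation D f"
  shows "(\<Sum>j\<in>I. class_flow D \<pi> f i j) = 0"
proof -
  have "(\<Sum>j\<in>I. class_flow D \<pi> f i j) = (\<Sum>e\<in>arcs D. \<Sum>j\<in>I.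
     (if \<pi> (tail D e) = i \<and> \<pi> (head D e) = j then f e else 0) -
     (if \<pi> (tail D e) = j \<and> \<pi> (head D e) = i then f e else 0))"
    unfolding class_flow_def by (rule sum.swap)
  also have "\<dots> = (\<Sum>e\<in>arcs D. (if \<pi> (tail D e) = i then f e else 0) - (if \<pi> (head D e) = i then f e else 0))"
  proof (intro sum.cong refl)
    fix e assume "e \<in> arcs D"
    then have *: "\<pi> (tail D e) \<in> I" "\<pi> (head D e) \<in> I" using ends \<pi> by auto
    have "(\<Sum>j\<in>I. if \<pi> (tail D e) = i \<and> \<pi> (head D e) = j then f e else 0) =
        (if \<pi> (tail D e) = i then f e else 0)"
      using * fin(3) by (cases "\<pi> (tail D e) = i") auto
    moreover have "(\<Sum>j\<in>I. if \<pi> (tail D e) = j \<and> \<pi> (head D e) = i then f e else 0) =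
        (if \<pi> (head D e) = i then f e else 0)"
      using * fin(3) by (cases "\<pi> (head D e) = i") auto
    ultimately show "(\<Sum>j\<in>I. (if \<pi> (tail D e) = i \<and> \<pi> (head D e) = j then f e else 0) -
         (if \<pi> (tail D e) = j \<and> \<pi> (head D e) = i then f e else 0)) =
        (if \<pi> (tail D e) = i then f e else 0) - (if \<pi> (head D e) = i then f e else 0)"
      by (simp add: sum_subtractf)
  qed
  also have "\<dots> = (\<Sum>e\<in>arcs D. \<Sum>v\<in>{v \<in> verts D. \<pi> v = i}.
      (if tail D e = v then f e else 0) - (if head D e = v then f e else 0))"
    using ends fin(2) by (intro sum.cong) (auto simp: sum_subtractf)
  also have "\<dots> = (\<Sum>v\<in>{v \<in> verts D. \<pi> v = i}. \<Sum>e\<in>arcs D.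
      (if tail D e = v then f e else 0) - (if head D e = v then f e else 0))"
    by (rule sum.swap)
  also have "\<dots> = 0" using f by (simp add: flow_conservation_iff[OF fin(1)])
  finally show ?thesis .
qed

lemma class_flow_unique_edge:
  assumes D: "finite_loopless G" "is_orientation G D" and "i \<noteq> j"
    and e: "e \<in> edges G" "\<pi> ` ends G e = {i, j}"
    and uniq: "\<And>e'. e' \<in> edges G \<Longrightarrow> \<pi> ` ends G e' = {i, j} \<Longrightarrow> e' = e"
  shows "class_flow D \<pi> f i j \<in> {f e, - f e}"
proof -
  have arcs: "arcs D = edges G" and ends: "\<And>x. x \<in> edges G \<Longrightarrow> ends G x = {tail D x, head D x}"
    using D(2) by (auto simp: is_orientation_def)
  have "class_flow D \<pi> f i j = (\<Sum>x\<in>{e}.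
     (if \<pi> (tail D x) = i \<and> \<pi> (head D x) = j then f x else 0) -
     (if \<pi> (tail D x) = j \<and> \<pi> (head D x) = i then f x else 0))"
    unfolding class_flow_def arcs
  proof (rule sum.mono_neutral_right)
    show "finite (edges G)" using D(1) by (simp add: finite_loopless_def)
    show "{e} \<subseteq> edges G" using e by simp
    show "\<forall>x\<in>edges G - {e}. (if \<pi> (tail D x) = i \<and> \<pi> (head D x) = j then f x else 0) -
     (if \<pi> (tail D x) = j \<and> \<pi> (head D x) = i then f x else 0) = 0"
    proof
      fix x assume x: "x \<in> edges G - {e}"
      then have "\<pi> ` ends G x \<noteq> {i, j}" using uniq by blast
      then have "{\<pi> (tail D x), \<pi> (head D x)} \<noteq> {i, j}" using x ends by simp
      then have "\<not> (\<pi> (tail D x) = i \<and> \<pi> (head D x) = j)" "\<not> (\<pi> (tail D x) = j \<and> \<pi> (head D x) = i)"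
        by blast+
      then show "(if \<pi> (tail D x) = i \<and> \<pi> (head D x) = j then f x else 0) -
       (if \<pi> (tail D x) = j \<and> \<pi> (head D x) = i then f x else 0) = 0"
        by (simp only: if_False diff_self)
    qed
  qed
  moreover have "\<pi> (tail D e) = i \<and> \<pi> (head D e) = j \<or> \<pi> (tail D e) = j \<and> \<pi> (head D e) = i"
  proof -
    have "{\<pi> (tail D e), \<pi> (head D e)} = {i, j}" using e ends by simp
    then show ?thesis by (simp only: doubleton_eq_iff)
  qed
  ultimately show ?thesis using \<open>i \<noteq> j\<close> by auto
qed

lemma phi_ge_of_contractible_K4:
  fixes G :: "('v, 'e) multigraph" and q :: real
  defines "g \<equiv> (if q \<le> 2 then 2 powr (1 - 1 / q) else 2 powr (1 / q))"
  assumes G: "finite_loopless G" and "contractible_to G K4" and q: "1 \<le> q"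
  shows "ereal (1 + g) \<le> phi TYPE(2) (ereal q) G"
  unfolding phi_def
proof (rule Inf_greatest, clarify)
  fix r D and f :: "'e \<Rightarrow> real ^ 2"
  assume "is_vector_NZF r (ereal q) G D f"
  then have D: "is_orientation G D" and f: "flow_conservation D f"
    and norm: "\<And>e. e \<in> edges G \<Longrightarrow> 1 \<le> pnorm (ereal q) (f e) \<and> pnorm (ereal q) (f e) \<le> r - 1"
    by (auto simp: is_vector_NZF_def is_vector_flow_def)
  have q0: "0 < q" using q by simp
  obtain \<pi> where \<pi>: "\<pi> ` vertices G \<subseteq> {..<4::nat}"
    "\<And>i j. i < 4 \<Longrightarrow> j < 4 \<Longrightarrow> i \<noteq> j \<Longrightarrow> \<exists>!e. e \<in> edges G \<and> \<pi> ` ends G e = {i, j}"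
    using contractible_K4_partition[OF \<open>contractible_to G K4\<close>] by blast
  define X where "X = class_flow D \<pi> f"
  have X: "1 \<le> pnorm (ereal q) (X i j)" "pnorm (ereal q) (X i j) \<le> r - 1"
    if ij: "i < 4" "j < 4" "i \<noteq> j" for i j
  proof -
    obtain e where e: "e \<in> edges G" "\<pi> ` ends G e = {i, j}"
      "\<And>e'. e' \<in> edges G \<Longrightarrow> \<pi> ` ends G e' = {i, j} \<Longrightarrow> e' = e"
      using \<pi>(2)[OF ij] by blast
    have "X i j \<in> {f e, - f e}"
      unfolding X_def by (rule class_flow_unique_edge[OF G D ij(3) e])
    then have "pnorm (ereal q) (X i j) = pnorm (ereal q) (f e)" by (auto simp: pnorm_minus)
    then show "1 \<le> pnorm (ereal q) (X i j)" "pnorm (ereal q) (X i j) \<le> r - 1"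
      using norm[OF e(1)] by auto
  qed
  have anti: "X j i = - X i j" for i j unfolding X_def by (rule class_flow_antisym)
  have "(\<Sum>j<4. X i j) = 0" if "i < 4" for i
    unfolding X_def
    by (rule class_flow_conservation[OF _ _ _ _ _ f])
      (use G D that \<pi>(1) orientation_ends[OF G D] in \<open>auto simp: finite_loopless_def is_orientation_def\<close>)
  moreover have "{..<4} = {0, 1, 2, 3 :: nat}" by auto
  ultimately have sum: "X i 0 + X i 1 + X i 2 + X i 3 = 0" if "i < 4" for i
    using that by (simp add: add.assoc)
  have diag: "X i i = 0" for i unfolding X_def class_flow_def by simp
  have sum0: "X 0 1 + X 0 2 + X 0 3 = 0" "X 1 0 + X 1 2 + X 1 3 = 0" "X 2 0 + X 2 1 + X 2 3 = 0"
    using sum[of 0] sum[of 1] sum[of 2] by (simp_all add: diag)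
  \<comment> \<open>\<open>K4\<close> is its own planar dual: the six edge values are the differences of the four points
    \<open>0\<close>, \<open>u\<close>, \<open>v\<close>, \<open>w\<close>.\<close>
  define u v w where "u = X 0 1" and "v = X 2 0" and "w = X 1 2"
  \<comment> \<open>\<open>u\<close>, \<open>v\<close>, \<open>w\<close> run around the triangle 0,
    1, 2. Conservation at the vertex shared by two of them turns their difference into the value on
    its edge to 3.\<close>
  have "u - v - X 3 0 = X 0 1 + X 0 2 + X 0 3"
    by (simp add: u_def v_def anti[of 2 0] anti[of 3 0] del: One_nat_def)
  then have uv: "u - v = X 3 0" by (simp only: sum0 right_minus_eq)
  have "u - w - X 1 3 = - (X 1 0 + X 1 2 + X 1 3)"
    by (simp add: u_def w_def anti[of 0 1] del: One_nat_def)
  then have uw: "u - w = X 1 3" by (simp only: sum0 minus_zero right_minus_eq)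
  have "v - w - X 3 2 = X 2 0 + X 2 1 + X 2 3"
    by (simp add: v_def w_def anti[of 1 2] anti[of 3 2] del: One_nat_def)
  then have vw: "v - w = X 3 2" by (simp only: sum0 right_minus_eq)
  have "g \<le> r - 1"
  proof (rule four_points_diameter[where N = "pnorm (ereal q)" and u = u and v = v and w = w])
    show "\<And>x. g * pnorm (ereal q) x \<le> pnorm (ereal q) (x - rot x)"
      unfolding g_def by (rule pnorm_ereal_diff_rot[OF q])
    show "0 \<le> g" by (simp add: g_def)
  qed (use X in \<open>simp_all add: uv[unfolded u_def v_def] uw[unfolded u_def w_def]
        vw[unfolded v_def w_def] u_def v_def w_def pnorm_ereal_triangle[OF q]
        pnorm_ereal_scale[OF q0] pnorm_ereal_rot del: One_nat_def\<close>)
  then show "ereal (1 + g) \<le> ereal r" by simp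
qed

theorem theorem1p9:
  fixes G :: "('v, 'e) multigraph"
  assumes "finite_loopless G" and "admits_NZF 4 G"
  shows "(\<forall>p::ereal. 1 \<le> p \<longrightarrow>
            (p \<le> 2 \<longrightarrow> phi TYPE(2) p G \<le> ereal (1 + 2 powr (1 - real_of_ereal (1 / p)))) \<and>
            (2 \<le> p \<longrightarrow> phi TYPE(2) p G \<le> ereal (1 + 2 powr real_of_ereal (1 / p)))) \<and>
         phi TYPE(2) 1 G = 2 \<and> phi TYPE(2) \<infinity> G = 2 \<and>
         (contractible_to G K4 \<longrightarrow>
           (\<forall>p::ereal. 1 \<le> p \<longrightarrow>
              (p \<le> 2 \<longrightarrow> phi TYPE(2) p G = ereal (1 + 2 powr (1 - real_of_ereal (1 / p)))) \<and>
              (2 \<le> p \<longrightarrow> phi TYPE(2) p G = ereal (1 + 2 powr real_of_ereal (1 / p)))))"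
proof (intro conjI impI allI)
  fix p :: ereal assume p: "1 \<le> p"
  show "phi TYPE(2) p G \<le> ereal (1 + 2 powr (1 - real_of_ereal (1 / p)))" if "p \<le> 2"
    by (rule phi_le_powr_conjugate[OF assms p that])
  show "phi TYPE(2) p G \<le> ereal (1 + 2 powr real_of_ereal (1 / p))" if "2 \<le> p"
    by (rule phi_le_powr_inverse[OF assms p])
next
  show "phi TYPE(2) 1 G = 2"
    using phi_le_powr_conjugate[OF assms, of 1] phi_ge_2[where p = 1 and 'd = 2 and G = G]
    by (simp add: one_ereal_def)
  show "phi TYPE(2) \<infinity> G = 2"
    using phi_le_powr_inverse[OF assms, of \<infinity>] phi_ge_2[where p = \<infinity> and 'd = 2 and G = G] by simp
next
  fix p :: ereal assume K4: "contractible_to G K4" and p: "1 \<le> p"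
  show "phi TYPE(2) p G = ereal (1 + 2 powr (1 - real_of_ereal (1 / p)))" if p2: "p \<le> 2"
  proof (rule antisym[OF phi_le_powr_conjugate[OF assms p p2]])
    obtain q where q: "p = ereal q" "1 \<le> q" "q \<le> 2" using p p2 by (cases p) auto
    then show "ereal (1 + 2 powr (1 - real_of_ereal (1 / p))) \<le> phi TYPE(2) p G"
      using phi_ge_of_contractible_K4[OF assms(1) K4 q(2)] by (simp add: one_ereal_def)
  qed
  show "phi TYPE(2) p G = ereal (1 + 2 powr real_of_ereal (1 / p))" if "2 \<le> p"
  proof (rule antisym[OF phi_le_powr_inverse[OF assms p]])
    show "ereal (1 + 2 powr real_of_ereal (1 / p)) \<le> phi TYPE(2) p G"
    proof (cases p)
      case (real q)
      then have q: "1 \<le> q" "2 \<le> q" using p that by auto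
      \<comment> \<open>The two branches agree at \<open>q = 2\<close>.\<close>
      have "(if q \<le> 2 then 2 powr (1 - 1 / q) else 2 powr (1 / q)) = (2::real) powr (1 / q)"
        using q by (cases "q = 2") auto
      then show ?thesis
        using phi_ge_of_contractible_K4[OF assms(1) K4 q(1)] real q by (simp add: one_ereal_def)
    next
      case PInf
      \<comment> \<open>Here \<open>1 / p\<close> is 0, so the bound is 2, which no flow index
        undercuts.\<close>
      then show ?thesis using phi_ge_2[where p = p and 'd = 2 and G = G] by simp
    next
      case MInf
      then show ?thesis using that by simp
    qed
  qed
qed

end
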